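(* Let $K$ be an algebraically closed field of arbitrary characteristic, let $\mathfrak{m}=\langle x_1,\ldots,x_n\rangle\subset K[[x_1,\ldots,x_n]]$, let $0\neq f\in\mathfrak{m}^2$ and let $k\in\mathbb{N}$. Write $\mathrm{j}(f)=\langle f_{x_1},\ldots,f_{x_n}\rangle$ for the ideal generated by the partial derivatives of $f$. (a) If $\mathfrak{m}^{k+2}\subseteq\mathfrak{m}^2\cdot\mathrm{j}(f)$, then $f$ is right $(2k-\operatorname{ord}(f)+2)$-determined. (b) If $\mathfrak{m}^{k+2}\subseteq\mathfrak{m}\cdot\langle f\rangle+\mathfrak{m}^2\cdot\mathrm{j}(f)$, then $f$ is contact $(2k-\operatorname{ord}(f)+2)$-determined.
   Context: $\operatorname{ord}(f)$ is the largest integer $o$ with $f\in\mathfrak{m}^o$. Power series $f,g$ are right equivalent if $f=\varphi(g)$ for some $K$-algebra automorphism $\varphi$ of $K[[x_1,\ldots,x_n]]$; they are contact equivalent if $f=u\cdot\varphi(g)$ for some such $\varphi$ and some unit $u$. $f$ is right (respectively contact) $N$-determined if $f$ is right (respectively contact) equivalent to every $g\in K[[x_1,\ldots,x_n]]$ with $f-g\in\mathfrak{m}^{N+1}$. *)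

theory Defs
  imports
    "HOL-Computational_Algebra.Polynomial"
    "HOL-Library.FuncSet"
    "HOL-Library.Function_Algebras"
    "HOL-Library.Set_Algebras"
begin

section \<open>Formal power series in finitely many variables\<close>

text \<open>
  \<open>('a, 'n) mps\<close> is the ring \<open>K[[x\<^sub>1,\<dots>,x\<^sub>n]]\<close> with coefficients in \<open>'a\<close> and variables indexed by
  the finite type \<open>'n\<close>, so that \<open>n = CARD('n)\<close>. A monomial is given by its exponent vector
  \<open>'n \<Rightarrow> nat\<close>, with pointwise addition from \<open>Function_Algebras\<close>.
\<close>

typedef ('a, 'n) mps = "UNIV :: (('n \<Rightarrow> nat) \<Rightarrow> 'a) set"
  morphisms mps_coeff Abs_mps ..

setup_lifting type_definition_mps

lemma mps_eqI: "(\<And>\<alpha>. mps_coeff f \<alpha> = mps_coeff g \<alpha>) \<Longrightarrow> f = g"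
  by transfer auto

lemma exponents_below_eq: "{(\<beta>, \<gamma>). \<beta> + \<gamma> = \<alpha>} = (\<lambda>\<beta>. (\<beta>, \<alpha> - \<beta>)) ` {\<beta>. \<beta> \<le> \<alpha>}"
  for \<alpha> :: "'n \<Rightarrow> nat"
proof -
  have "\<gamma> = \<alpha> - \<beta>" "\<beta> \<le> \<alpha>" if "\<beta> + \<gamma> = \<alpha>" for \<beta> \<gamma>
    using that by (auto simp: le_fun_def)
  moreover have "\<beta> + (\<alpha> - \<beta>) = \<alpha>" if "\<beta> \<le> \<alpha>" for \<beta>
    using that by (simp add: le_fun_def fun_eq_iff)
  ultimately show ?thesis
    by auto
qed

lemma finite_exponents_le: "finite {\<beta>. \<beta> \<le> \<alpha>}"
  for \<alpha> :: "'n::finite \<Rightarrow> nat"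
proof (rule finite_subset)
  show "{\<beta>. \<beta> \<le> \<alpha>} \<subseteq> Pi\<^sub>E UNIV (\<lambda>i. {..\<alpha> i})"
    by (auto simp: le_fun_def PiE_def extensional_def)
  show "finite (Pi\<^sub>E UNIV (\<lambda>i. {..\<alpha> i}))"
    by (intro finite_PiE) auto
qed

lemma finite_exponent_pairs [simp]: "finite {(\<beta>, \<gamma>). \<beta> + \<gamma> = \<alpha>}"
  for \<alpha> :: "'n::finite \<Rightarrow> nat"
  unfolding exponents_below_eq by (intro finite_imageI finite_exponents_le)

instantiation mps :: (comm_ring_1, finite) comm_ring_1
begin

lift_definition zero_mps :: "('a, 'b) mps" is "\<lambda>_. 0" .
lift_definition one_mps :: "('a, 'b) mps" is "\<lambda>\<alpha>. if \<alpha> = 0 then 1 else 0" .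
lift_definition plus_mps :: "('a, 'b) mps \<Rightarrow> ('a, 'b) mps \<Rightarrow> ('a, 'b) mps"
  is "\<lambda>f g \<alpha>. f \<alpha> + g \<alpha>" .
lift_definition minus_mps :: "('a, 'b) mps \<Rightarrow> ('a, 'b) mps \<Rightarrow> ('a, 'b) mps"
  is "\<lambda>f g \<alpha>. f \<alpha> - g \<alpha>" .
lift_definition uminus_mps :: "('a, 'b) mps \<Rightarrow> ('a, 'b) mps"
  is "\<lambda>f \<alpha>. - f \<alpha>" .
lift_definition times_mps :: "('a, 'b) mps \<Rightarrow> ('a, 'b) mps \<Rightarrow> ('a, 'b) mps"
  is "\<lambda>f g \<alpha>. \<Sum>(\<beta>, \<gamma>) | \<beta> + \<gamma> = \<alpha>. f \<beta> * g \<gamma>" .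

instance
proof
  fix f g h :: "('a, 'b) mps"
  show "f + g + h = f + (g + h)"
    by transfer (simp add: add.assoc)
  show "f + g = g + f"
    by transfer (simp add: add.commute)
  show "0 + f = f"
    by transfer simp
  show "- f + f = 0"
    by transfer simp
  show "f - g = f + - g"
    by transfer simp
  show "(0 :: ('a, 'b) mps) \<noteq> 1"
    by transfer (auto simp: fun_eq_iff)
  show "(f + g) * h = f * h + g * h"
    by transfer (simp add: ring_distribs case_prod_unfold flip: sum.distrib)
  show "f * g = g * f"
  proof (rule mps_eqI)
    fix \<alpha>
    show "mps_coeff (f * g) \<alpha> = mps_coeff (g * f) \<alpha>"
      unfolding times_mps.rep_eq
      by (rule sum.reindex_bij_witness[of _ prod.swap prod.swap])
        (auto simp: mult.commute add.commute)
  qed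
  show "1 * f = f"
  proof (rule mps_eqI)
    fix \<alpha>
    have "mps_coeff (1 * f) \<alpha> = (\<Sum>(\<beta>, \<gamma>) | \<beta> + \<gamma> = \<alpha>. if \<beta> = 0 then mps_coeff f \<gamma> else 0)"
      unfolding times_mps.rep_eq one_mps.rep_eq by (intro sum.cong) auto
    also have "\<dots> = (\<Sum>(\<beta>, \<gamma>) \<in> {(0 :: 'b \<Rightarrow> nat, \<alpha>)}. mps_coeff f \<gamma>)"
      by (rule sum.mono_neutral_cong_right) (auto split: if_splits)
    finally show "mps_coeff (1 * f) \<alpha> = mps_coeff f \<alpha>"
      by simp
  qed
  show "f * g * h = f * (g * h)"
  proof (rule mps_eqI)
    fix \<alpha>
    let ?P = "\<lambda>\<alpha>. {(\<beta>, \<gamma>). \<beta> + \<gamma> = (\<alpha> :: 'b \<Rightarrow> nat)}"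
    let ?f = "mps_coeff f" and ?g = "mps_coeff g" and ?h = "mps_coeff h"
    have "mps_coeff (f * g * h) \<alpha>
      = (\<Sum>p \<in> ?P \<alpha>. \<Sum>q \<in> ?P (fst p). ?f (fst q) * ?g (snd q) * ?h (snd p))"
      unfolding times_mps.rep_eq by (simp add: case_prod_unfold sum_distrib_right)
    also have "\<dots> = (\<Sum>(p, q) \<in> Sigma (?P \<alpha>) (\<lambda>p. ?P (fst p)). ?f (fst q) * ?g (snd q) * ?h (snd p))"
      by (rule sum.Sigma) auto
    also have "\<dots> = (\<Sum>(p, q) \<in> Sigma (?P \<alpha>) (\<lambda>p. ?P (snd p)). ?f (fst p) * (?g (fst q) * ?h (snd q)))"
      by (rule sum.reindex_bij_witness[of _ "\<lambda>((a, b), (c, d)). ((a + c, d), (a, c))"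
            "\<lambda>((a, b), (c, d)). ((c, d + b), (d, b))"])
        (auto simp: algebra_simps)
    also have "\<dots> = (\<Sum>p \<in> ?P \<alpha>. \<Sum>q \<in> ?P (snd p). ?f (fst p) * (?g (fst q) * ?h (snd q)))"
      by (rule sum.Sigma[symmetric]) auto
    also have "\<dots> = mps_coeff (f * (g * h)) \<alpha>"
      unfolding times_mps.rep_eq by (simp add: case_prod_unfold sum_distrib_left)
    finally show "mps_coeff (f * g * h) \<alpha> = mps_coeff (f * (g * h)) \<alpha>" .
  qed
qed

end

definition unit_exponent :: "'n \<Rightarrow> 'n \<Rightarrow> nat"
  where "unit_exponent i = (\<lambda>j. if j = i then 1 else 0)"

lift_definition mps_const :: "'a::zero \<Rightarrow> ('a, 'n) mps"
  is "\<lambda>c \<alpha>. if \<alpha> = 0 then c else 0" .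

lift_definition mps_var :: "'n \<Rightarrow> ('a::zero_neq_one, 'n) mps"
  is "\<lambda>i \<alpha>. if \<alpha> = unit_exponent i then 1 else 0" .

text \<open>
  The formal partial derivative
  \<open>\<partial>/\<partial>x\<^sub>i (\<Sum>\<^sub>\<alpha> c\<^sub>\<alpha> x\<^sup>\<alpha>) = \<Sum>\<^sub>\<alpha> \<alpha>\<^sub>i c\<^sub>\<alpha> x\<^bsup>\<alpha> - e\<^sub>i\<^esup>\<close>.
\<close>

lift_definition mps_deriv :: "'n \<Rightarrow> ('a::comm_ring_1, 'n) mps \<Rightarrow> ('a, 'n) mps"
  is "\<lambda>i f \<alpha>. of_nat (\<alpha> i + 1) * f (\<alpha> + unit_exponent i)" .


section \<open>Ideals\<close>

text \<open>An ideal of a commutative ring is a submodule of the ring, viewed as a module over itself.\<close>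

global_interpretation ideal: module "(*) :: 'a::comm_ring_1 \<Rightarrow> 'a \<Rightarrow> 'a"
  defines ideal = ideal.span
  by standard (auto simp: algebra_simps)

text \<open>
  The product of sets \<open>I * J\<close> from \<open>Set_Algebras\<close> only consists of the elementwise products, hence
  the additional \<open>ideal\<close>. The sum of sets \<open>I + J\<close>, by contrast, is the sum of ideals.
\<close>

definition ideal_prod :: "'a::comm_ring_1 set \<Rightarrow> 'a set \<Rightarrow> 'a set"  (infixl \<open>\<cdot>\<^sub>i\<close> 70)
  where "I \<cdot>\<^sub>i J = ideal {a * b | a b. a \<in> I \<and> b \<in> J}"

primrec ideal_power :: "'a::comm_ring_1 set \<Rightarrow> nat \<Rightarrow> 'a set"  (infixr \<open>^\<^sub>i\<close> 80)
  where
    "I ^\<^sub>i 0 = UNIV"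
  | "I ^\<^sub>i Suc k = I \<cdot>\<^sub>i (I ^\<^sub>i k)"

definition max_ideal :: "('a::comm_ring_1, 'n::finite) mps set"  (\<open>\<mm>\<close>)
  where "\<mm> = ideal (range mps_var)"

definition jacobian_ideal :: "('a::comm_ring_1, 'n::finite) mps \<Rightarrow> ('a, 'n) mps set"
  where "jacobian_ideal f = ideal (range (\<lambda>i. mps_deriv i f))"

text \<open>Only meaningful for \<open>f \<noteq> 0\<close>, since otherwise there is no greatest such \<open>d\<close>.\<close>

definition mps_ord :: "('a::comm_ring_1, 'n::finite) mps \<Rightarrow> nat"
  where "mps_ord f = (GREATEST d. f \<in> \<mm> ^\<^sub>i d)"


section \<open>Right and contact equivalence, finite determinacy\<close>

text \<open>No continuity is demanded of the automorphisms.\<close>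

definition mps_automorphism :: "(('a::comm_ring_1, 'n::finite) mps \<Rightarrow> ('a, 'n) mps) \<Rightarrow> bool"
  where "mps_automorphism \<phi> \<longleftrightarrow>
    bij \<phi> \<and>
    (\<forall>f g. \<phi> (f + g) = \<phi> f + \<phi> g) \<and>
    (\<forall>f g. \<phi> (f * g) = \<phi> f * \<phi> g) \<and>
    (\<forall>c. \<phi> (mps_const c) = mps_const c)"

definition right_equivalent :: "('a::comm_ring_1, 'n::finite) mps \<Rightarrow> ('a, 'n) mps \<Rightarrow> bool"
  where "right_equivalent f g \<longleftrightarrow> (\<exists>\<phi>. mps_automorphism \<phi> \<and> f = \<phi> g)"

definition contact_equivalent :: "('a::comm_ring_1, 'n::finite) mps \<Rightarrow> ('a, 'n) mps \<Rightarrow> bool"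
  where "contact_equivalent f g \<longleftrightarrow> (\<exists>\<phi> u. mps_automorphism \<phi> \<and> u dvd 1 \<and> f = u * \<phi> g)"

definition right_determined :: "nat \<Rightarrow> ('a::comm_ring_1, 'n::finite) mps \<Rightarrow> bool"
  where "right_determined N f \<longleftrightarrow> (\<forall>g. f - g \<in> \<mm> ^\<^sub>i (N + 1) \<longrightarrow> right_equivalent f g)"

definition contact_determined :: "nat \<Rightarrow> ('a::comm_ring_1, 'n::finite) mps \<Rightarrow> bool"
  where "contact_determined N f \<longleftrightarrow> (\<forall>g. f - g \<in> \<mm> ^\<^sub>i (N + 1) \<longrightarrow> contact_equivalent f g)"

end

theory Submission
  imports Defs
begin

text \<open>
  The automorphism is found by solving \<open>f = u \<cdot> g(y)\<close> for a unit \<open>u\<close> and coordinates \<open>y\<close> by successive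
  approximation, starting from \<open>u = 1\<close> and \<open>y = x\<close>. The hypothesis forces \<open>k + 1 \<ge> e\<close> for
  \<open>e = ord(f)\<close>; put \<open>k + 1 = e + q\<close>, so that \<open>f - g\<close> has order at least \<open>e + 2q + 1\<close>. If the error
  \<open>u \<cdot> g(y) - f\<close> has order at least \<open>e + 2q + 1 + p\<close>, then the hypothesis, multiplied by \<open>\<mm>\<^bsup>q+p\<^esup>\<close>,
  writes it as \<open>c f + \<Sum>\<^sub>i b\<^sub>i f\<^sub>x\<^sub>i\<close> with \<open>c \<in> \<mm>\<^bsup>q+p+1\<^esup>\<close> and \<open>b\<^sub>i \<in> \<mm>\<^bsup>q+p+2\<^esup>\<close>, and by Taylor expansion
  passing to \<open>u - c\<close> and \<open>y - b\<close> raises the order of the error by at least one. The limit \<open>y\<close>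
  agrees with \<open>x\<close> modulo \<open>\<mm>\<^sup>2\<close>, hence substituting it is an automorphism. In the right case \<open>c = 0\<close>
  throughout, so \<open>u = 1\<close>.
\<close>

section \<open>The order filtration\<close>

abbreviation total_degree :: "('n::finite \<Rightarrow> nat) \<Rightarrow> nat"
  where "total_degree \<alpha> \<equiv> sum \<alpha> UNIV"

text \<open>Coefficientwise form of the ideal power \<open>\<mm> ^\<^sub>i d\<close>; the two are
  identified in \<open>max_ideal_power\<close>. This keeps ideal generation out of the
  estimates.\<close>

definition order_ge :: "nat \<Rightarrow> ('a::comm_ring_1, 'n::finite) mps set"
  where "order_ge d = {f. \<forall>\<alpha>. total_degree \<alpha> < d \<longrightarrow> mps_coeff f \<alpha> = 0}"

lemma order_geI: "(\<And>\<alpha>. total_degree \<alpha> < d \<Longrightarrow> mps_coeff f \<alpha> = 0) \<Longrightarrow> f \<in> order_ge d"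
  by (simp add: order_ge_def)

lemma order_geD: "f \<in> order_ge d \<Longrightarrow> total_degree \<alpha> < d \<Longrightarrow> mps_coeff f \<alpha> = 0"
  by (simp add: order_ge_def)

lemma order_ge_0 [simp]: "order_ge 0 = UNIV"
  by (simp add: order_ge_def)

lemma order_ge_mono: "f \<in> order_ge d \<Longrightarrow> e \<le> d \<Longrightarrow> f \<in> order_ge e"
  by (auto simp: order_ge_def)

lemma zero_in_order_ge [simp]: "0 \<in> order_ge d"
  by (simp add: order_ge_def zero_mps.rep_eq)

lemma order_ge_add: "f \<in> order_ge d \<Longrightarrow> g \<in> order_ge d \<Longrightarrow> f + g \<in> order_ge d"
  by (simp add: order_ge_def plus_mps.rep_eq)

lemma order_ge_diff: "f \<in> order_ge d \<Longrightarrow> g \<in> order_ge d \<Longrightarrow> f - g \<in> order_ge d"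
  by (simp add: order_ge_def minus_mps.rep_eq)

lemma order_ge_minus: "f \<in> order_ge d \<Longrightarrow> - f \<in> order_ge d"
  by (simp add: order_ge_def uminus_mps.rep_eq)

lemma order_ge_minus_swap: "f - g \<in> order_ge d \<Longrightarrow> g - f \<in> order_ge d"
  using order_ge_minus[of "f - g" d] by simp

lemma order_ge_sum: "(\<And>i. i \<in> A \<Longrightarrow> f i \<in> order_ge d) \<Longrightarrow> sum f A \<in> order_ge d"
  by (induction A rule: infinite_finite_induct) (auto intro: order_ge_add)

lemma total_degree_add: "total_degree (\<alpha> + \<beta>) = total_degree \<alpha> + total_degree \<beta>"
  by (simp add: sum.distrib)

lemma order_ge_mult:
  assumes "f \<in> order_ge d" "g \<in> order_ge e" "c \<le> d + e"
  shows "f * g \<in> order_ge c"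
proof (rule order_geI)
  fix \<alpha> :: "'b \<Rightarrow> nat" assume "total_degree \<alpha> < c"
  then have "mps_coeff f \<beta> * mps_coeff g \<gamma> = 0" if "\<beta> + \<gamma> = \<alpha>" for \<beta> \<gamma>
    using that assms order_geD[of f d \<beta>] order_geD[of g e \<gamma>] total_degree_add[of \<beta> \<gamma>]
    by (cases "total_degree \<beta> < d") auto
  then show "mps_coeff (f * g) \<alpha> = 0"
    unfolding times_mps.rep_eq by (intro sum.neutral) auto
qed

lemma order_ge_mult_left: "g \<in> order_ge d \<Longrightarrow> f * g \<in> order_ge d"
  using order_ge_mult[of f 0 g d d] by simp

text \<open>Separation of the filtration: every exponent has finite total degree, so some
  \<open>d\<close> exceeds it. Equalities of series are often proved below by bounding the order of
  the difference by every \<open>d\<close>.\<close>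

lemma order_ge_all_imp_0:
  assumes "\<And>d. f \<in> order_ge d"
  shows "f = 0"
  using assms by (intro mps_eqI) (metis lessI order_geD zero_mps.rep_eq)

lemma order_ge_all_imp_eq: "(\<And>d. f - g \<in> order_ge d) \<Longrightarrow> f = g"
  using order_ge_all_imp_0[of "f - g"] by simp

text \<open>Completeness of the filtration: increments from stage \<open>p\<close> on have order at
  least \<open>p\<close>, so each coefficient is eventually constant.\<close>

lemma order_ge_limit:
  fixes X :: "nat \<Rightarrow> ('a::comm_ring_1, 'n::finite) mps"
  assumes "\<And>p. X (Suc p) - X p \<in> order_ge p"
  obtains L where "\<And>p. L - X p \<in> order_ge p"
proof
  fix p
  have diff: "X (p + j) - X p \<in> order_ge p" for p j
  proof (induction j)
    case (Suc j)
    have "X (p + Suc j) - X p = (X (Suc (p + j)) - X (p + j)) + (X (p + j) - X p)"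
      by simp
    then show ?case
      using Suc assms[of "p + j"] by (metis order_ge_add order_ge_mono le_add1)
  qed simp
  \<comment> \<open>Coefficients of total degree below \<open>p\<close> no longer change from stage
    \<open>p\<close> on, so the one at \<alpha> is read off at stage
    \<open>total_degree \<alpha> + 1\<close>.\<close>
  show "Abs_mps (\<lambda>\<alpha>. mps_coeff (X (Suc (total_degree \<alpha>))) \<alpha>) - X p \<in> order_ge p"
  proof (rule order_geI)
    fix \<alpha> :: "'n \<Rightarrow> nat" assume "total_degree \<alpha> < p"
    then have "mps_coeff (X p - X (Suc (total_degree \<alpha>))) \<alpha> = 0"
      using diff[of "Suc (total_degree \<alpha>)" "p - Suc (total_degree \<alpha>)"]
      by (intro order_geD[where d = "Suc (total_degree \<alpha>)"]) auto
    then show "mps_coeff (Abs_mps (\<lambda>\<alpha>. mps_coeff (X (Suc (total_degree \<alpha>))) \<alpha>) - X p) \<alpha> = 0"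
      by (simp add: minus_mps.rep_eq Abs_mps_inverse)
  qed
qed

text \<open>Writing \<open>T = id + \<tau>\<close>, the preimage of \<open>g\<close> is the Neumann series \<open>\<Sum>\<^sub>n (-\<tau>)\<^sup>n g\<close>.\<close>

lemma bij_of_raises_order:
  fixes T :: "('a::comm_ring_1, 'n::finite) mps \<Rightarrow> ('a, 'n) mps"
  assumes add: "\<And>f g. T (f + g) = T f + T g"
    and raise: "\<And>f d. f \<in> order_ge d \<Longrightarrow> T f - f \<in> order_ge (Suc d)"
  shows "bij T"
proof (rule bijI)
  have diff: "T (f - g) = T f - T g" for f g
    using add[of "f - g" g] by simp
  have pres: "T f \<in> order_ge d" if "f \<in> order_ge d" for f d
    using order_ge_add[of "T f - f" d f] order_ge_mono[OF raise[OF that], of d] that by simp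
  show "inj T"
  proof (rule injI)
    fix f g assume "T f = T g"
    then have T0: "T (f - g) = 0"
      by (simp add: diff)
    \<comment> \<open>If \<open>T h = 0\<close> then \<open>h = - (T h - h)\<close>, so a bound
      \<open>d\<close> on the order of \<open>h\<close> always improves to
      \<open>d + 1\<close>.\<close>
    have "f - g \<in> order_ge d" for d
    proof (induction d)
      case (Suc d)
      then show ?case
        using raise[OF Suc] order_ge_minus[of "T (f - g) - (f - g)" "Suc d"] T0 by simp
    qed simp
    then show "f = g"
      by (rule order_ge_all_imp_eq)
  qed
  show "surj T"
    unfolding surj_def
  proof
    fix g
    define r where "r n = ((\<lambda>h. h - T h) ^^ n) g" for n
    have r: "r n \<in> order_ge n" for n
      by (induction n) (simp_all add: r_def order_ge_minus_swap raise)
    define X where "X p = (\<Sum>n<p. r n)" for p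
    \<comment> \<open>Telescoping, since \<open>r (Suc n) = r n - T (r n)\<close>; the defect
      \<open>r p\<close> has order at least \<open>p\<close>.\<close>
    have TX: "T (X p) = g - r p" for p
    proof (induction p)
      case 0
      show ?case
        using add[of 0 0] by (simp add: X_def r_def)
    next
      case (Suc p)
      have "X (Suc p) = X p + r p" "r (Suc p) = r p - T (r p)"
        by (simp_all add: X_def r_def)
      then show ?case
        using Suc by (simp add: add)
    qed
    obtain L where L: "L - X p \<in> order_ge p" for p
      using order_ge_limit[of X] r by (auto simp: X_def)
    have "T L - g \<in> order_ge p" for p
    proof -
      have "T L - g = T (L - X p) - r p"
        by (simp add: diff TX)
      then show ?thesis
        using order_ge_diff[OF pres[OF L] r] by simp
    qed
    then have "T L = g"
      by (rule order_ge_all_imp_eq)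
    then show "\<exists>h. g = T h"
      by blast
  qed
qed

text \<open>Multiplication by \<open>u\<close> differs from the identity by a map that raises
  orders, hence is bijective; the preimage of 1 is the inverse.\<close>

lemma unit_of_one_plus_order_ge_1:
  fixes u :: "('a::comm_ring_1, 'n::finite) mps"
  assumes "u - 1 \<in> order_ge 1"
  shows "u dvd 1"
proof -
  have "bij ((*) u)"
  proof (rule bij_of_raises_order)
    fix f :: "('a, 'n) mps" and d assume "f \<in> order_ge d"
    then show "u * f - f \<in> order_ge (Suc d)"
      using order_ge_mult[OF assms, of f d "Suc d"] by (simp add: algebra_simps)
  qed (simp add: algebra_simps)
  then obtain v where "u * v = 1"
    by (metis bij_pointE)
  then show ?thesis
    by (metis dvd_triv_left)
qed


section \<open>Variables, constants and derivatives\<close>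

lemma total_degree_unit_exponent [simp]: "total_degree (unit_exponent i) = 1"
  by (simp add: unit_exponent_def)

lemma unit_exponent_neq_0 [simp]: "unit_exponent i \<noteq> 0"
  by (auto simp: fun_eq_iff unit_exponent_def)

lemma diff_unit_exponent_add: "\<alpha> i > 0 \<Longrightarrow> \<alpha> - unit_exponent i + unit_exponent i = \<alpha>"
  by (auto simp: fun_eq_iff unit_exponent_def)

lemma add_unit_exponent_diff [simp]: "\<alpha> + unit_exponent i - unit_exponent i = (\<alpha> :: 'n \<Rightarrow> nat)"
  by (auto simp: fun_eq_iff unit_exponent_def)

lemma add_unit_exponent_pos [simp]: "(\<alpha> + unit_exponent i) i > 0"
  by (simp add: unit_exponent_def)

lemma mps_coeff_var_mult:
  "mps_coeff (mps_var i * h) \<alpha> = (if \<alpha> i > 0 then mps_coeff h (\<alpha> - unit_exponent i) else 0)"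
  for h :: "('a::comm_ring_1, 'n::finite) mps"
proof -
  have "mps_coeff (mps_var i * h) \<alpha>
    = (\<Sum>(\<beta>, \<gamma>) | \<beta> + \<gamma> = \<alpha>. if \<beta> = unit_exponent i then mps_coeff h \<gamma> else 0)"
    unfolding times_mps.rep_eq mps_var.rep_eq by (intro sum.cong) auto
  also have "\<dots> = (\<Sum>(\<beta>, \<gamma>) \<in> (if \<alpha> i > 0 then {(unit_exponent i, \<alpha> - unit_exponent i)} else {}).
      mps_coeff h \<gamma>)"
  proof (rule sum.mono_neutral_cong_right)
    show "(if \<alpha> i > 0 then {(unit_exponent i, \<alpha> - unit_exponent i)} else {})
      \<subseteq> {(\<beta>, \<gamma>). \<beta> + \<gamma> = \<alpha>}"
      using diff_unit_exponent_add[of \<alpha> i] by (auto simp: add.commute)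
    have "\<alpha> i > 0 \<and> \<gamma> = \<alpha> - unit_exponent i" if "unit_exponent i + \<gamma> = \<alpha>" for \<gamma>
      using add_unit_exponent_diff[of \<gamma> i] add_unit_exponent_pos[of \<gamma> i] that
      by (simp only: add.commute)
    then show "\<forall>x\<in>{(\<beta>, \<gamma>). \<beta> + \<gamma> = \<alpha>} -
        (if \<alpha> i > 0 then {(unit_exponent i, \<alpha> - unit_exponent i)} else {}).
        (case x of (\<beta>, \<gamma>) \<Rightarrow> if \<beta> = unit_exponent i then mps_coeff h \<gamma> else 0) = 0"
      by (auto split: if_splits)
  qed (auto split: if_splits)
  finally show ?thesis
    by simp
qed

lemma mps_coeff_const_mult: "mps_coeff (mps_const c * h) \<alpha> = c * mps_coeff h \<alpha>"
  for h :: "('a::comm_ring_1, 'n::finite) mps"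
proof -
  have "mps_coeff (mps_const c * h) \<alpha>
    = (\<Sum>(\<beta>, \<gamma>) | \<beta> + \<gamma> = \<alpha>. if \<beta> = 0 then c * mps_coeff h \<gamma> else 0)"
    unfolding times_mps.rep_eq mps_const.rep_eq by (intro sum.cong) auto
  also have "\<dots> = (\<Sum>(\<beta>, \<gamma>) \<in> {(0 :: 'n \<Rightarrow> nat, \<alpha>)}. c * mps_coeff h \<gamma>)"
    by (rule sum.mono_neutral_cong_right) (auto split: if_splits)
  finally show ?thesis
    by simp
qed

lemma var_in_order_ge: "mps_var i \<in> order_ge 1"
  by (rule order_geI) (metis less_irrefl mps_var.rep_eq total_degree_unit_exponent)

lemma near_var_in_order_ge:
  assumes "z - mps_var i \<in> order_ge d" "1 \<le> d"
  shows "z \<in> order_ge 1"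
  using order_ge_add[OF order_ge_mono[OF assms] var_in_order_ge[of i]] by simp

text \<open>Drives the inductions on the order: a claim about \<open>f\<close> is reduced to the
  series \<open>g i\<close>, whose order bound is one lower.\<close>

lemma order_ge_Suc_decompose:
  fixes f :: "('a::comm_ring_1, 'n::finite) mps"
  assumes f: "f \<in> order_ge (Suc d)"
  obtains g where "\<And>i. g i \<in> order_ge d" "f = (\<Sum>i\<in>UNIV. mps_var i * g i)"
proof -
  text \<open>Each non-constant monomial of \<open>f\<close> is assigned to one of the variables dividing it.\<close>
  define \<iota> :: "('n \<Rightarrow> nat) \<Rightarrow> 'n" where "\<iota> \<alpha> = (SOME i. \<alpha> i > 0)" for \<alpha>
  define g where "g i = Abs_mps (\<lambda>\<beta>. if \<iota> (\<beta> + unit_exponent i) = i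
      then mps_coeff f (\<beta> + unit_exponent i) else 0)" for i
  have coeff_g: "mps_coeff (g i) \<beta> = (if \<iota> (\<beta> + unit_exponent i) = i
      then mps_coeff f (\<beta> + unit_exponent i) else 0)" for i \<beta>
    by (simp add: g_def Abs_mps_inverse)
  have coeff_sum: "mps_coeff (sum h A) \<alpha> = (\<Sum>i\<in>A. mps_coeff (h i) \<alpha>)"
    for h :: "'n \<Rightarrow> ('a, 'n) mps" and A \<alpha>
    by (induction A rule: infinite_finite_induct) (auto simp: zero_mps.rep_eq plus_mps.rep_eq)
  show ?thesis
  proof
    show "g i \<in> order_ge d" for i
    proof (rule order_geI)
      fix \<alpha> :: "'n \<Rightarrow> nat" assume "total_degree \<alpha> < d"
      then have "mps_coeff f (\<alpha> + unit_exponent i) = 0"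
        by (intro order_geD[OF f]) (simp add: total_degree_add del: plus_fun_apply)
      then show "mps_coeff (g i) \<alpha> = 0"
        by (simp add: coeff_g)
    qed
    show "f = (\<Sum>i\<in>UNIV. mps_var i * g i)"
    proof (rule mps_eqI)
      fix \<alpha>
      \<comment> \<open>Only the index \<open>\<iota> \<alpha>\<close> can contribute at \<alpha>,
        so no monomial is counted twice.\<close>
      have "mps_coeff (mps_var i * g i) \<alpha> = (if \<alpha> i > 0 \<and> \<iota> \<alpha> = i then mps_coeff f \<alpha> else 0)" for i
        using diff_unit_exponent_add[of \<alpha> i] by (auto simp: mps_coeff_var_mult coeff_g)
      then have sum_eq: "mps_coeff (\<Sum>i\<in>UNIV. mps_var i * g i) \<alpha>
        = (\<Sum>i\<in>UNIV. if \<alpha> i > 0 \<and> \<iota> \<alpha> = i then mps_coeff f \<alpha> else 0)"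
        by (simp add: coeff_sum)
      show "mps_coeff f \<alpha> = mps_coeff (\<Sum>i\<in>UNIV. mps_var i * g i) \<alpha>"
      proof (cases "\<exists>i. \<alpha> i > 0")
        case True
        then have "\<alpha> (\<iota> \<alpha>) > 0"
          unfolding \<iota>_def by (rule someI_ex)
        then have "(\<Sum>i\<in>UNIV. if \<alpha> i > 0 \<and> \<iota> \<alpha> = i then mps_coeff f \<alpha> else 0)
          = (\<Sum>i\<in>UNIV. if \<iota> \<alpha> = i then mps_coeff f \<alpha> else 0)"
          by (intro sum.cong) auto
        then show ?thesis
          using sum_eq by simp
      next
        case False
        then have "mps_coeff f \<alpha> = 0"
          by (intro order_geD[OF f]) simp
        then show ?thesis
          using sum_eq False by simp
      qed
    qed
  qed
qed

text \<open>Serves inductions on the precision of an estimate rather than on the order of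
  \<open>f\<close>; there the series \<open>g i\<close> may be arbitrary.\<close>

lemma mps_decompose:
  fixes f :: "('a::comm_ring_1, 'n::finite) mps"
  obtains c g where "f = mps_const c + (\<Sum>i\<in>UNIV. mps_var i * g i)"
proof -
  have "f - mps_const (mps_coeff f 0) \<in> order_ge (Suc 0)"
  proof (rule order_geI)
    fix \<alpha> :: "'n \<Rightarrow> nat" assume "total_degree \<alpha> < Suc 0"
    then have "\<alpha> = 0"
      by (simp add: fun_eq_iff)
    then show "mps_coeff (f - mps_const (mps_coeff f 0)) \<alpha> = 0"
      by (simp add: minus_mps.rep_eq mps_const.rep_eq)
  qed
  then obtain g where "f - mps_const (mps_coeff f 0) = (\<Sum>i\<in>UNIV. mps_var i * g i)"
    by (rule order_ge_Suc_decompose)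
  then show ?thesis
    using that[of "mps_coeff f 0" g] by (simp add: algebra_simps)
qed

section \<open>Formal partial derivatives\<close>

lemma mps_deriv_add: "mps_deriv i (f + g) = mps_deriv i f + mps_deriv i g"
  for f g :: "('a::comm_ring_1, 'n::finite) mps"
  by (rule mps_eqI) (simp add: mps_deriv.rep_eq plus_mps.rep_eq algebra_simps)

lemma mps_deriv_diff: "mps_deriv i (f - g) = mps_deriv i f - mps_deriv i g"
  for f g :: "('a::comm_ring_1, 'n::finite) mps"
  by (rule mps_eqI) (simp add: mps_deriv.rep_eq minus_mps.rep_eq algebra_simps)

lemma mps_deriv_const: "mps_deriv i (mps_const c) = (0 :: ('a::comm_ring_1, 'n::finite) mps)"
proof (rule mps_eqI)
  fix \<alpha> :: "'n \<Rightarrow> nat"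
  show "mps_coeff (mps_deriv i (mps_const c)) \<alpha> = mps_coeff (0 :: ('a, 'n) mps) \<alpha>"
    by (simp add: mps_deriv.rep_eq mps_const.rep_eq zero_mps.rep_eq)
qed

text \<open>The Leibniz rule with a variable as one factor, which is the form required when series
  are taken apart one variable at a time.\<close>

lemma mps_deriv_var_mult:
  fixes h :: "('a::comm_ring_1, 'n::finite) mps"
  shows "mps_deriv j (mps_var i * h) = (if i = j then h else 0) + mps_var i * mps_deriv j h"
proof (rule mps_eqI)
  fix \<alpha> :: "'n \<Rightarrow> nat"
  show "mps_coeff (mps_deriv j (mps_var i * h)) \<alpha>
    = mps_coeff ((if i = j then h else 0) + mps_var i * mps_deriv j h) \<alpha>"
  proof (cases "i = j")
    case True
    show ?thesis
    proof (cases "\<alpha> i > 0")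
      case pos: True
      \<comment> \<open>On coefficients the rule becomes
        \<open>(\<alpha> i + 1) * h = h + \<alpha> i * h\<close>.\<close>
      have "(\<alpha> - unit_exponent i) i + 1 = \<alpha> i"
        using pos by (simp add: unit_exponent_def)
      then have "mps_coeff (mps_deriv i h) (\<alpha> - unit_exponent i) = of_nat (\<alpha> i) * mps_coeff h \<alpha>"
        using diff_unit_exponent_add[of \<alpha> i, OF pos] by (simp add: mps_deriv.rep_eq del: of_nat_Suc of_nat_add)
      moreover have "mps_coeff (mps_deriv i (mps_var i * h)) \<alpha> = of_nat (\<alpha> i + 1) * mps_coeff h \<alpha>"
        by (simp add: mps_deriv.rep_eq mps_coeff_var_mult del: plus_fun_apply)
      ultimately show ?thesis
        using True pos by (simp add: plus_mps.rep_eq mps_coeff_var_mult distrib_right)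
    next
      case False
      then show ?thesis
        using True by (simp add: plus_mps.rep_eq mps_coeff_var_mult mps_deriv.rep_eq del: plus_fun_apply)
    qed
  next
    case False
    have "(\<alpha> + unit_exponent j) i = \<alpha> i" "(\<alpha> - unit_exponent i) j = \<alpha> j"
      using False by (auto simp: unit_exponent_def)
    moreover have "\<alpha> + unit_exponent j - unit_exponent i = \<alpha> - unit_exponent i + unit_exponent j"
      using False by (auto simp: fun_eq_iff unit_exponent_def)
    ultimately show ?thesis
      using False
      by (simp add: plus_mps.rep_eq mps_coeff_var_mult mps_deriv.rep_eq zero_mps.rep_eq
          del: plus_fun_apply)
  qed
qed

text \<open>For \<open>d = 0\<close> the truncated subtraction gives the trivial bound 0.\<close>

lemma mps_deriv_in_order_ge:
  assumes "f \<in> order_ge d"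
  shows "mps_deriv i f \<in> order_ge (d - 1)"
proof (rule order_geI)
  fix \<alpha> :: "'b \<Rightarrow> nat" assume "total_degree \<alpha> < d - 1"
  then have "mps_coeff f (\<alpha> + unit_exponent i) = 0"
    by (intro order_geD[OF assms]) (simp add: total_degree_add del: plus_fun_apply)
  then show "mps_coeff (mps_deriv i f) \<alpha> = 0"
    by (simp add: mps_deriv.rep_eq)
qed


section \<open>Substitution\<close>

definition mps_monom_eval :: "('n::finite \<Rightarrow> ('a::comm_ring_1, 'n) mps) \<Rightarrow> ('n \<Rightarrow> nat) \<Rightarrow> ('a, 'n) mps"
  where "mps_monom_eval y \<alpha> = (\<Prod>i\<in>UNIV. y i ^ \<alpha> i)"

text \<open>
  Only meaningful if all \<open>y i\<close> have zero constant term: then \<open>y\<^sup>\<alpha>\<close> has order at least \<open>|\<alpha>|\<close>, so that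
  the monomials omitted from the sum do not contribute.
\<close>

definition mps_subst :: "('n::finite \<Rightarrow> ('a::comm_ring_1, 'n) mps) \<Rightarrow> ('a, 'n) mps \<Rightarrow> ('a, 'n) mps"
  where "mps_subst y f = Abs_mps (\<lambda>\<beta>. \<Sum>\<alpha> | total_degree \<alpha> \<le> total_degree \<beta>.
    mps_coeff f \<alpha> * mps_coeff (mps_monom_eval y \<alpha>) \<beta>)"

lemma finite_total_degree_le [simp]: "finite {\<alpha> :: 'n::finite \<Rightarrow> nat. total_degree \<alpha> \<le> D}"
proof (rule finite_subset)
  show "{\<alpha> :: 'n \<Rightarrow> nat. total_degree \<alpha> \<le> D} \<subseteq> {\<alpha>. \<alpha> \<le> (\<lambda>_. D)}"
  proof (clarsimp simp: le_fun_def)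
    fix \<alpha> :: "'n \<Rightarrow> nat" and i assume "total_degree \<alpha> \<le> D"
    then show "\<alpha> i \<le> D"
      using member_le_sum[of i UNIV \<alpha>] by simp
  qed
qed (rule finite_exponents_le)

lemma mps_monom_eval_in_order_ge:
  assumes "\<And>i. y i \<in> order_ge 1"
  shows "mps_monom_eval y \<alpha> \<in> order_ge (total_degree \<alpha>)"
proof -
  have pow: "y i ^ n \<in> order_ge n" for i n
    by (induction n) (auto intro: order_ge_mult[OF assms])
  have "(\<Prod>i\<in>A. y i ^ \<alpha> i) \<in> order_ge (sum \<alpha> A)" for A
    by (induction A rule: infinite_finite_induct) (auto intro: order_ge_mult[OF pow])
  then show ?thesis
    by (simp add: mps_monom_eval_def)
qed

lemma mps_monom_eval_add_unit: "mps_monom_eval y (\<alpha> + unit_exponent i) = y i * mps_monom_eval y \<alpha>"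
proof -
  have "(\<Prod>j\<in>UNIV. y j ^ unit_exponent i j) = (\<Prod>j\<in>UNIV. if j = i then y j else 1)"
    by (intro prod.cong) (auto simp: unit_exponent_def)
  then show ?thesis
    by (simp add: mps_monom_eval_def power_add prod.distrib mult.commute)
qed

text \<open>The terms beyond total degree \<open>total_degree \<beta>\<close> vanish because
  \<open>mps_monom_eval y \<alpha>\<close> has order at least \<open>total_degree \<alpha>\<close>.
  The free cutoff \<open>D\<close> allows one range of summation for several exponents.\<close>

lemma mps_coeff_subst:
  assumes "\<And>i. y i \<in> order_ge 1" "total_degree \<beta> \<le> D"
  shows "mps_coeff (mps_subst y f) \<beta>
    = (\<Sum>\<alpha> | total_degree \<alpha> \<le> D. mps_coeff f \<alpha> * mps_coeff (mps_monom_eval y \<alpha>) \<beta>)"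
  unfolding mps_subst_def Abs_mps_inverse[OF UNIV_I]
proof (rule sum.mono_neutral_left)
  show "\<forall>\<alpha>\<in>{\<alpha>. total_degree \<alpha> \<le> D} - {\<alpha>. total_degree \<alpha> \<le> total_degree \<beta>}.
      mps_coeff f \<alpha> * mps_coeff (mps_monom_eval y \<alpha>) \<beta> = 0"
    using order_geD[OF mps_monom_eval_in_order_ge[of y]] assms by auto
qed (use assms in auto)

locale substitution =
  fixes y :: "'n::finite \<Rightarrow> ('a::comm_ring_1, 'n) mps"
  assumes y: "\<And>i. y i \<in> order_ge 1"
begin

lemma add: "mps_subst y (f + g) = mps_subst y f + mps_subst y g"
  by (rule mps_eqI)
    (simp add: mps_coeff_subst[OF y order_refl] plus_mps.rep_eq sum.distrib algebra_simps)

lemma const_mult: "mps_subst y (mps_const c * f) = mps_const c * mps_subst y f"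
  by (rule mps_eqI)
    (simp only: mps_coeff_subst[OF y order_refl] mps_coeff_const_mult sum_distrib_left mult.assoc)

lemma one: "mps_subst y 1 = 1"
proof (rule mps_eqI)
  fix \<beta> :: "'n \<Rightarrow> nat"
  have "mps_coeff (mps_subst y 1) \<beta> = (\<Sum>\<alpha> :: 'n \<Rightarrow> nat | total_degree \<alpha> \<le> total_degree \<beta>.
      if \<alpha> = 0 then mps_coeff (mps_monom_eval y 0) \<beta> else 0)"
    unfolding mps_coeff_subst[OF y order_refl] by (rule sum.cong[OF refl]) (auto simp: one_mps.rep_eq)
  then show "mps_coeff (mps_subst y 1) \<beta> = mps_coeff 1 \<beta>"
    by (simp add: mps_monom_eval_def)
qed

lemma const: "mps_subst y (mps_const c) = mps_const c"
proof -
  have "mps_const c * 1 = (mps_const c :: ('a, 'n) mps)"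
    by simp
  then show ?thesis
    using const_mult[of c 1] by (simp add: one)
qed

lemma zero: "mps_subst y 0 = 0"
  using add[of 0 0] by simp

lemma diff: "mps_subst y (f - g) = mps_subst y f - mps_subst y g"
  using add[of "f - g" g] by simp

lemma sum: "mps_subst y (sum h A) = (\<Sum>i\<in>A. mps_subst y (h i))"
  by (induction A rule: infinite_finite_induct) (simp_all add: zero add)

lemma var_mult: "mps_subst y (mps_var i * h) = y i * mps_subst y h"
proof (rule mps_eqI)
  fix \<beta> :: "'n \<Rightarrow> nat"
  define D where "D = total_degree \<beta>"
  let ?e = "mps_monom_eval y"
  \<comment> \<open>The cutoff is \<open>Suc D\<close> because removing one factor
    \<open>x_i\<close> lowers the total degree by one and leaves the cutoff \<open>D\<close> for
    \<open>h\<close>.\<close>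
  have "mps_coeff (mps_subst y (mps_var i * h)) \<beta>
    = (\<Sum>\<alpha> | total_degree \<alpha> \<le> Suc D. mps_coeff (mps_var i * h) \<alpha> * mps_coeff (?e \<alpha>) \<beta>)"
    by (rule mps_coeff_subst[OF y]) (simp add: D_def)
  also have "\<dots> = (\<Sum>\<alpha> | total_degree \<alpha> \<le> Suc D \<and> \<alpha> i > 0.
      mps_coeff h (\<alpha> - unit_exponent i) * mps_coeff (?e \<alpha>) \<beta>)"
    by (rule sum.mono_neutral_cong_right) (auto simp: mps_coeff_var_mult)
  also have "\<dots> = (\<Sum>\<alpha> | total_degree \<alpha> \<le> D. mps_coeff h \<alpha> * mps_coeff (?e (\<alpha> + unit_exponent i)) \<beta>)"
  proof (rule sum.reindex_bij_witness[of _ "\<lambda>\<alpha>. \<alpha> + unit_exponent i" "\<lambda>\<alpha>. \<alpha> - unit_exponent i"])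
    fix \<alpha> :: "'n \<Rightarrow> nat"
    assume \<alpha>: "\<alpha> \<in> {\<alpha>. total_degree \<alpha> \<le> Suc D \<and> \<alpha> i > 0}"
    then show eq: "\<alpha> - unit_exponent i + unit_exponent i = \<alpha>"
      by (intro diff_unit_exponent_add) auto
    show "\<alpha> - unit_exponent i \<in> {\<alpha>. total_degree \<alpha> \<le> D}"
      using \<alpha> total_degree_add[of "\<alpha> - unit_exponent i" "unit_exponent i"] unfolding eq by simp
    show "mps_coeff h (\<alpha> - unit_exponent i)
          * mps_coeff (?e (\<alpha> - unit_exponent i + unit_exponent i)) \<beta>
        = mps_coeff h (\<alpha> - unit_exponent i) * mps_coeff (?e \<alpha>) \<beta>"
      unfolding eq by (rule refl)
  next
    fix \<alpha> :: "'n \<Rightarrow> nat" assume "\<alpha> \<in> {\<alpha>. total_degree \<alpha> \<le> D}"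
    then show "\<alpha> + unit_exponent i \<in> {\<alpha>. total_degree \<alpha> \<le> Suc D \<and> \<alpha> i > 0}"
      using add_unit_exponent_pos[of \<alpha> i] total_degree_add[of \<alpha> "unit_exponent i"]
      by (simp del: plus_fun_apply)
  qed simp
  also have "\<dots> = (\<Sum>\<alpha> | total_degree \<alpha> \<le> D. mps_coeff h \<alpha> * mps_coeff (y i * ?e \<alpha>) \<beta>)"
    by (simp add: mps_monom_eval_add_unit del: plus_fun_apply)
  also have "\<dots> = (\<Sum>\<alpha> | total_degree \<alpha> \<le> D. \<Sum>(\<gamma>, \<delta>) | \<gamma> + \<delta> = \<beta>.
      mps_coeff h \<alpha> * (mps_coeff (y i) \<gamma> * mps_coeff (?e \<alpha>) \<delta>))"
    unfolding times_mps.rep_eq by (simp add: sum_distrib_left case_prod_unfold)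
  also have "\<dots> = (\<Sum>(\<gamma>, \<delta>) | \<gamma> + \<delta> = \<beta>. \<Sum>\<alpha> | total_degree \<alpha> \<le> D.
      mps_coeff h \<alpha> * (mps_coeff (y i) \<gamma> * mps_coeff (?e \<alpha>) \<delta>))"
    unfolding case_prod_unfold by (rule sum.swap)
  also have "\<dots> = (\<Sum>(\<gamma>, \<delta>) | \<gamma> + \<delta> = \<beta>. mps_coeff (y i) \<gamma> * mps_coeff (mps_subst y h) \<delta>)"
  proof (rule sum.cong[OF refl], unfold case_prod_unfold)
    fix p assume "p \<in> {p. fst p + snd p = \<beta>}"
    \<comment> \<open>The common cutoff \<open>D\<close> remains valid at the smaller exponent
      \<open>snd p\<close>.\<close>
    then have "total_degree (snd p) \<le> D"
      by (auto simp: D_def sum.distrib)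
    show "(\<Sum>\<alpha> | total_degree \<alpha> \<le> D. mps_coeff h \<alpha> * (mps_coeff (y i) (fst p) * mps_coeff (?e \<alpha>) (snd p)))
      = mps_coeff (y i) (fst p) * mps_coeff (mps_subst y h) (snd p)"
      unfolding mps_coeff_subst[OF y \<open>total_degree (snd p) \<le> D\<close>] sum_distrib_left
      by (intro sum.cong refl mult.left_commute)
  qed
  also have "\<dots> = mps_coeff (y i * mps_subst y h) \<beta>"
    by (simp only: times_mps.rep_eq)
  finally show "mps_coeff (mps_subst y (mps_var i * h)) \<beta> = mps_coeff (y i * mps_subst y h) \<beta>" .
qed

text \<open>Avoids multiplying out powers of \<open>y\<close>: by \<open>var_mult\<close>, the
  defect for \<open>f\<close> is the sum of \<open>y i\<close> times the defect for
  \<open>g i\<close>. It thus gains one order with every decomposition and must vanish.\<close>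

lemma mult: "mps_subst y (f * h) = mps_subst y f * mps_subst y h"
proof (rule order_ge_all_imp_eq)
  fix d
  show "mps_subst y (f * h) - mps_subst y f * mps_subst y h \<in> order_ge d"
  proof (induction d arbitrary: f)
    case (Suc d)
    obtain c g where f: "f = mps_const c + (\<Sum>i\<in>UNIV. mps_var i * g i)"
      by (rule mps_decompose)
    have "mps_subst y (f * h) - mps_subst y f * mps_subst y h
      = (\<Sum>i\<in>UNIV. y i * (mps_subst y (g i * h) - mps_subst y (g i) * mps_subst y h))"
      unfolding f
      by (simp only: distrib_right sum_distrib_right add sum const const_mult var_mult mult.assoc
          right_diff_distrib sum_subtractf add_diff_cancel_left)
    also have "\<dots> \<in> order_ge (Suc d)"
      by (intro order_ge_sum order_ge_mult[OF y Suc]) simp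
    finally show ?case .
  qed simp
qed

lemma in_order_ge: "f \<in> order_ge d \<Longrightarrow> mps_subst y f \<in> order_ge d"
proof (induction d arbitrary: f)
  case (Suc d)
  obtain g where "\<And>i. g i \<in> order_ge d" "f = (\<Sum>i\<in>UNIV. mps_var i * g i)"
    using Suc.prems by (rule order_ge_Suc_decompose) blast
  then show ?case
    using Suc.IH by (auto simp: sum var_mult intro!: order_ge_sum order_ge_mult[OF y])
qed simp

text \<open>If \<open>y\<close> agrees with the variables up to order 2, substitution changes only
  higher-order terms, so \<open>bij_of_raises_order\<close> applies.\<close>

lemma automorphism:
  assumes "\<And>i. y i - mps_var i \<in> order_ge 2"
  shows "mps_automorphism (mps_subst y)"
proof -
  have "mps_subst y f - f \<in> order_ge (Suc d)" if "f \<in> order_ge d" for f d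
    using that
  proof (induction d arbitrary: f)
    case 0
    obtain c g where f: "f = mps_const c + (\<Sum>i\<in>UNIV. mps_var i * g i)"
      by (rule mps_decompose)
    \<comment> \<open>Constants are fixed, so only terms with a factor \<open>y i\<close> or
      \<open>mps_var i\<close> survive.\<close>
    have "mps_subst y f - f = (\<Sum>i\<in>UNIV. y i * mps_subst y (g i) - mps_var i * g i)"
      by (simp add: f add const sum var_mult sum_subtractf)
    also have "\<dots> \<in> order_ge (Suc 0)"
      by (intro order_ge_sum order_ge_diff order_ge_mult[OF y, of _ 0]
          order_ge_mult[OF var_in_order_ge, of _ 0]) simp_all
    finally show ?case .
  next
    case (Suc d)
    obtain g where g: "\<And>i. g i \<in> order_ge d" and f: "f = (\<Sum>i\<in>UNIV. mps_var i * g i)"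
      using Suc.prems by (rule order_ge_Suc_decompose) blast
    \<comment> \<open>The first summand has order \<open>1 + Suc d\<close> by induction, the second
      order \<open>2 + d\<close> by the assumption on \<open>y\<close>.\<close>
    have "mps_subst y f - f
      = (\<Sum>i\<in>UNIV. y i * (mps_subst y (g i) - g i) + (y i - mps_var i) * g i)"
      by (simp add: f sum var_mult algebra_simps flip: sum_subtractf)
    also have "\<dots> \<in> order_ge (Suc (Suc d))"
      by (intro order_ge_sum order_ge_add order_ge_mult[OF y Suc.IH[OF g]]
          order_ge_mult[OF assms g]) simp_all
    finally show ?case .
  qed
  then have "bij (mps_subst y)"
    by (intro bij_of_raises_order add)
  then show ?thesis
    by (simp add: mps_automorphism_def add mult const)
qed

end

section \<open>Comparing two substitutions\<close>

lemma mps_subst_var: "mps_subst mps_var f = f"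
proof (rule order_ge_all_imp_eq)
  interpret substitution mps_var
    by standard (rule var_in_order_ge)
  fix d
  show "mps_subst mps_var f - f \<in> order_ge d"
  proof (induction d arbitrary: f)
    case (Suc d)
    obtain c g where f: "f = mps_const c + (\<Sum>i\<in>UNIV. mps_var i * g i)"
      by (rule mps_decompose)
    have "mps_subst mps_var f - f = (\<Sum>i\<in>UNIV. mps_var i * (mps_subst mps_var (g i) - g i))"
      by (simp add: f add const sum var_mult sum_subtractf right_diff_distrib)
    also have "\<dots> \<in> order_ge (Suc d)"
      by (intro order_ge_sum order_ge_mult[OF var_in_order_ge Suc]) simp
    finally show ?case .
  qed simp
qed

text \<open>Heuristically, changing one of the \<open>d\<close> factors of a monomial contributes
  \<open>t\<close>, and each of the other \<open>d - 1\<close> factors contributes 1. The product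
  rule \<open>E_var_mult\<close> carries this out one variable at a time.\<close>

lemma mps_subst_lipschitz:
  fixes y z :: "'n::finite \<Rightarrow> ('a::comm_ring_1, 'n) mps"
  assumes y: "\<And>i. y i \<in> order_ge 1" and z: "\<And>i. z i \<in> order_ge 1"
    and diff: "\<And>i. z i - y i \<in> order_ge t"
    and f: "f \<in> order_ge d"
  shows "mps_subst z f - mps_subst y f \<in> order_ge (t + d - 1)"
proof -
  interpret y: substitution y by standard (rule y)
  interpret z: substitution z by standard (rule z)
  define E where "E f = mps_subst z f - mps_subst y f" for f
  have E_add: "E (f + g) = E f + E g" for f g
    by (simp add: E_def y.add z.add)
  have E_const: "E (mps_const c) = 0" for c
    by (simp add: E_def y.const z.const)
  have E_var_mult: "E (mps_var i * g) = z i * E g + (z i - y i) * mps_subst y g" for i g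
    unfolding E_def y.var_mult z.var_mult by (simp add: right_diff_distrib left_diff_distrib)
  have E_sum: "E (sum h A) = (\<Sum>i\<in>A. E (h i))" for h :: "'n \<Rightarrow> ('a, 'n) mps" and A
    by (simp add: E_def y.sum z.sum sum_subtractf)
  \<comment> \<open>Here \<open>f\<close> is arbitrary; the bound stops at \<open>t\<close> because
    the summand \<open>(z i - y i) * mps_subst y (g i)\<close> is only known to have order
    \<open>t\<close>.\<close>
  have E0: "E f \<in> order_ge e" if "e \<le> t" for e f
    using that
  proof (induction e arbitrary: f)
    case (Suc e)
    obtain c g where f: "f = mps_const c + (\<Sum>i\<in>UNIV. mps_var i * g i)"
      by (rule mps_decompose)
    have IH: "E (g i) \<in> order_ge e" for i
      using Suc by simp
    have "E f = (\<Sum>i\<in>UNIV. z i * E (g i) + (z i - y i) * mps_subst y (g i))"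
      unfolding f E_add E_const E_sum E_var_mult by simp
    also have "\<dots> \<in> order_ge (Suc e)"
      using Suc.prems
      by (intro order_ge_sum order_ge_add order_ge_mult[OF z IH] order_ge_mult[OF diff, of _ 0]) simp_all
    finally show ?case .
  qed simp
  have "E f \<in> order_ge (t + d - 1)"
  proof (cases d)
    case 0
    then show ?thesis
      by (intro E0) simp
  next
    case (Suc d')
    \<comment> \<open>Writing \<open>d = Suc d'\<close> removes the truncated subtraction; for
      \<open>d' = 0\<close> the bound is already \<open>E0\<close>.\<close>
    have "E f \<in> order_ge (t + d')"
      using f unfolding Suc
    proof (induction d' arbitrary: f)
      case 0
      then show ?case
        by (intro E0) simp
    next
      case (Suc d')
      obtain g where g: "\<And>i. g i \<in> order_ge (Suc d')" and f: "f = (\<Sum>i\<in>UNIV. mps_var i * g i)"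
        using Suc.prems by (rule order_ge_Suc_decompose) blast
      have "E f = (\<Sum>i\<in>UNIV. z i * E (g i) + (z i - y i) * mps_subst y (g i))"
        unfolding f E_sum E_var_mult ..
      also have "\<dots> \<in> order_ge (t + Suc d')"
        by (intro order_ge_sum order_ge_add order_ge_mult[OF z Suc.IH[OF g]]
            order_ge_mult[OF diff y.in_order_ge[OF g]]) simp_all
      finally show ?case .
    qed
    then show ?thesis
      by (simp add: Suc)
  qed
  then show ?thesis
    by (simp add: E_def)
qed

text \<open>
  The second-order Taylor estimate holds in every characteristic, since the remainder vanishes on
  constants and satisfies a product rule with respect to multiplication by a variable.
\<close>

lemma mps_subst_taylor:
  fixes y z :: "'n::finite \<Rightarrow> ('a::comm_ring_1, 'n) mps"
  assumes y: "\<And>i. y i \<in> order_ge 1" and z: "\<And>i. z i \<in> order_ge 1"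
    and diff: "\<And>i. z i - y i \<in> order_ge t"
    and f: "f \<in> order_ge (d + 2)"
  shows "mps_subst z f - mps_subst y f - (\<Sum>j\<in>UNIV. (z j - y j) * mps_subst y (mps_deriv j f))
    \<in> order_ge (2 * t + d)"
proof -
  interpret y: substitution y by standard (rule y)
  interpret z: substitution z by standard (rule z)
  define L where "L f = (\<Sum>j\<in>UNIV. (z j - y j) * mps_subst y (mps_deriv j f))" for f
  define R where "R f = mps_subst z f - mps_subst y f - L f" for f
  have L_add: "L (f + g) = L f + L g" for f g
    by (simp add: L_def mps_deriv_add y.add distrib_left sum.distrib)
  have L_const: "L (mps_const c) = 0" for c
    by (simp add: L_def mps_deriv_const y.zero)
  \<comment> \<open>\<open>L\<close> is a derivation along \<open>mps_subst y\<close>, with value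
    \<open>z i - y i\<close> at the variable \<open>i\<close>.\<close>
  have L_var_mult: "L (mps_var i * g) = (z i - y i) * mps_subst y g + y i * L g" for i g
  proof -
    have "L (mps_var i * g) = (\<Sum>j\<in>UNIV. (if i = j then (z j - y j) * mps_subst y g else 0)
        + y i * ((z j - y j) * mps_subst y (mps_deriv j g)))"
      unfolding L_def mps_deriv_var_mult y.add y.var_mult
      by (intro sum.cong refl) (simp add: y.zero distrib_left mult.left_commute)
    then have "L (mps_var i * g)
      = (\<Sum>j\<in>UNIV. if i = j then (z j - y j) * mps_subst y g else 0) + y i * L g"
      by (simp only: sum.distrib sum_distrib_left L_def)
    then show ?thesis
      by simp
  qed
  have R_add: "R (f + g) = R f + R g" for f g
    by (simp add: R_def L_add y.add z.add)
  have R_const: "R (mps_const c) = 0" for c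
    by (simp add: R_def L_const y.const z.const)
  \<comment> \<open>In the cross term \<open>(z i - y i) * L g\<close> the difference of
    \<open>z\<close> and \<open>y\<close> enters a second time; this is the source of
    \<open>2 * t\<close>.\<close>
  have R_var_mult: "R (mps_var i * g) = z i * R g + (z i - y i) * L g" for i g
    unfolding R_def L_var_mult y.var_mult z.var_mult
    by (simp add: right_diff_distrib left_diff_distrib)
  have R_sum: "R (sum h A) = (\<Sum>i\<in>A. R (h i))" for h :: "'n \<Rightarrow> ('a, 'n) mps" and A
    using R_const[of 0] R_add[of 0 0]
    by (induction A rule: infinite_finite_induct) (simp_all add: R_add)
  have L_in: "L f \<in> order_ge (t + (d - 1))" if "f \<in> order_ge d" for f d
    unfolding L_def
    by (intro order_ge_sum order_ge_mult[OF diff y.in_order_ge[OF mps_deriv_in_order_ge[OF that]]] order_refl)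
  have R0: "R f \<in> order_ge e" if "e \<le> 2 * t" for e f
    using that
  proof (induction e arbitrary: f)
    case (Suc e)
    obtain c g where f: "f = mps_const c + (\<Sum>i\<in>UNIV. mps_var i * g i)"
      by (rule mps_decompose)
    have IH: "R (g i) \<in> order_ge e" for i
      using Suc by simp
    have "R f = (\<Sum>i\<in>UNIV. z i * R (g i) + (z i - y i) * L (g i))"
      unfolding f R_add R_const R_sum R_var_mult by simp
    also have "\<dots> \<in> order_ge (Suc e)"
      using Suc.prems L_in[of _ 0]
      by (intro order_ge_sum order_ge_add order_ge_mult[OF z IH] order_ge_mult[OF diff, of _ t]) simp_all
    finally show ?case .
  qed simp
  \<comment> \<open>In the induction step \<open>g i\<close> has order \<open>d + 2\<close>, so
    \<open>L (g i)\<close> has order \<open>t + d + 1\<close> and the cross term has order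
    \<open>2 * t + Suc d\<close>.\<close>
  have "R f \<in> order_ge (2 * t + d)"
    using f
  proof (induction d arbitrary: f)
    case 0
    then show ?case
      using R0 by simp
  next
    case (Suc d)
    obtain g where g: "\<And>i. g i \<in> order_ge (d + 2)" and f: "f = (\<Sum>i\<in>UNIV. mps_var i * g i)"
      using order_ge_Suc_decompose[of f "d + 2"] Suc.prems by auto
    have "R f = (\<Sum>i\<in>UNIV. z i * R (g i) + (z i - y i) * L (g i))"
      unfolding f R_sum R_var_mult ..
    also have "\<dots> \<in> order_ge (2 * t + Suc d)"
      by (intro order_ge_sum order_ge_add order_ge_mult[OF z Suc.IH[OF g]]
          order_ge_mult[OF diff L_in[OF g]]) simp_all
    finally show ?case .
  qed
  then show ?thesis
    by (simp add: R_def L_def)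
qed

section \<open>Ideals and the order filtration\<close>

lemma subspace_order_ge: "ideal.subspace (order_ge d)"
  by (simp add: ideal.subspace_def order_ge_add order_ge_mult_left)

lemma max_ideal_subset: "\<mm> \<subseteq> order_ge 1"
  unfolding max_ideal_def by (rule ideal.span_minimal) (use var_in_order_ge subspace_order_ge in auto)

text \<open>Translates ideal powers into order conditions. One inclusion holds because orders add
  under multiplication, the other because \<open>order_ge_Suc_decompose\<close> exhibits a
  combination of the variables.\<close>

lemma max_ideal_power: "\<mm> ^\<^sub>i d = (order_ge d :: ('a::comm_ring_1, 'n::finite) mps set)"
proof (induction d)
  case (Suc d)
  have "{a * b | a b. a \<in> \<mm> \<and> b \<in> order_ge d} \<subseteq> (order_ge (Suc d) :: ('a, 'n) mps set)"
    using max_ideal_subset order_ge_mult[where d = 1 and e = d and c = "Suc d"] by fastforce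
  then have "\<mm> \<cdot>\<^sub>i order_ge d \<subseteq> (order_ge (Suc d) :: ('a, 'n) mps set)"
    unfolding ideal_prod_def by (rule ideal.span_minimal[OF _ subspace_order_ge])
  moreover have "f \<in> \<mm> \<cdot>\<^sub>i order_ge d" if f: "f \<in> order_ge (Suc d)" for f :: "('a, 'n) mps"
  proof -
    obtain g where g: "\<And>i. g i \<in> order_ge d" and f: "f = (\<Sum>i\<in>UNIV. mps_var i * g i)"
      using f by (rule order_ge_Suc_decompose) blast
    have "mps_var i \<in> (\<mm> :: ('a, 'n) mps set)" for i
      unfolding max_ideal_def by (intro ideal.span_base rangeI)
    then have "mps_var i * g i \<in> \<mm> \<cdot>\<^sub>i order_ge d" for i
      unfolding ideal_prod_def using g by (intro ideal.span_base) blast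
    then show ?thesis
      unfolding f ideal_prod_def by (intro ideal.span_sum)
  qed
  ultimately show ?case
    using Suc by auto
qed simp

text \<open>The combinations with coefficients of order at least \<open>d\<close> form an ideal that
  contains all products of \<open>A\<close> with \<open>ideal (range v)\<close>. The general index
  type covers both the partial derivatives and the single generator \<open>f\<close>.\<close>

lemma order_ge_prod_ideal_range:
  fixes v :: "'i::finite \<Rightarrow> ('a::comm_ring_1, 'n::finite) mps"
  assumes "A \<subseteq> order_ge d" "h \<in> A \<cdot>\<^sub>i ideal (range v)"
  obtains b where "\<And>i. b i \<in> order_ge d" "h = (\<Sum>i\<in>UNIV. b i * v i)"
proof -
  define C where "C d = {\<Sum>i\<in>UNIV. b i * v i | b. \<forall>i. b i \<in> order_ge d}" for d
  have C_I: "(\<Sum>i\<in>UNIV. b i * v i) \<in> C d" if "\<And>i. b i \<in> order_ge d" for b d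
    using that by (auto simp: C_def)
  have C_E: "\<exists>b. (\<forall>i. b i \<in> order_ge d) \<and> x = (\<Sum>i\<in>UNIV. b i * v i)" if "x \<in> C d" for x d
    using that by (auto simp: C_def)
  have scale: "a * x \<in> C d" if a: "a \<in> order_ge d" and x: "x \<in> C 0" for a x d
  proof -
    obtain b where b: "x = (\<Sum>i\<in>UNIV. b i * v i)"
      using C_E[OF x] by blast
    have "a * x = (\<Sum>i\<in>UNIV. a * b i * v i)"
      by (simp only: b sum_distrib_left mult.assoc)
    then show ?thesis
      using C_I[of "\<lambda>i. a * b i" d] order_ge_mult[OF a, of _ 0 d] by simp
  qed
  have subspace: "ideal.subspace (C d)" for d
    unfolding ideal.subspace_def
  proof (intro conjI ballI allI)
    show "0 \<in> C d"
      using C_I[of "\<lambda>_. 0" d] by simp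
    fix x assume "x \<in> C d"
    then obtain b where b: "\<And>i. b i \<in> order_ge d" "x = (\<Sum>i\<in>UNIV. b i * v i)"
      using C_E by blast
    have "c * x = (\<Sum>i\<in>UNIV. c * b i * v i)" for c
      by (simp only: b sum_distrib_left mult.assoc)
    then show "c * x \<in> C d" for c
      using C_I[of "\<lambda>i. c * b i" d] b by (simp add: order_ge_mult_left)
    fix x' assume "x' \<in> C d"
    then obtain b' where b': "\<And>i. b' i \<in> order_ge d" "x' = (\<Sum>i\<in>UNIV. b' i * v i)"
      using C_E by blast
    show "x + x' \<in> C d"
      using C_I[of "\<lambda>i. b i + b' i" d] b b' by (simp add: distrib_right sum.distrib order_ge_add)
  qed
  have "v i \<in> C 0" for i
  proof -
    have "(\<Sum>j\<in>UNIV. (if j = i then 1 else 0) * v j) = (\<Sum>j\<in>UNIV. if j = i then v j else 0)"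
      by (intro sum.cong) auto
    then show ?thesis
      using C_I[of "\<lambda>j. if j = i then 1 else 0" 0] by simp
  qed
  then have "ideal (range v) \<subseteq> C 0"
    by (intro ideal.span_minimal subspace) auto
  then have "A \<cdot>\<^sub>i ideal (range v) \<subseteq> C d"
    unfolding ideal_prod_def using assms(1) scale
    by (intro ideal.span_minimal subspace) blast
  then show ?thesis
    using that C_E assms(2) by blast
qed

section \<open>The order of a power series\<close>

lemma order_ge_subset_imp_le:
  assumes "order_ge m \<subseteq> (order_ge e :: ('a::comm_ring_1, 'n::finite) mps set)"
  shows "e \<le> m"
proof -
  \<comment> \<open>Types are nonempty, so there is a variable; the witness is the monomial
    \<open>x_i ^ m\<close>, of order exactly \<open>m\<close>.\<close>
  obtain i :: 'n where True by simp
  define \<alpha> where "\<alpha> j = (if j = i then m else 0)" for j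
  have \<alpha>: "total_degree \<alpha> = m"
    by (simp add: \<alpha>_def)
  define f :: "('a, 'n) mps" where "f = Abs_mps (\<lambda>\<beta>. if \<beta> = \<alpha> then 1 else 0)"
  have coeff: "mps_coeff f \<beta> = (if \<beta> = \<alpha> then 1 else 0)" for \<beta>
    by (simp add: f_def Abs_mps_inverse)
  have "f \<in> order_ge m"
    by (rule order_geI) (use \<alpha> in \<open>auto simp: coeff\<close>)
  then have "f \<in> order_ge e"
    using assms by blast
  then show ?thesis
    using order_geD[of f e \<alpha>] \<alpha> by (force simp: coeff)
qed

lemma
  fixes f :: "('a::comm_ring_1, 'n::finite) mps"
  assumes "f \<noteq> 0"
  shows in_order_ge_mps_ord: "f \<in> order_ge (mps_ord f)"
    and le_mps_ord: "f \<in> order_ge d \<Longrightarrow> d \<le> mps_ord f"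
proof -
  \<comment> \<open>A nonzero coefficient bounds all admissible \<open>d\<close>, so the greatest
    one exists.\<close>
  obtain \<alpha> where "mps_coeff f \<alpha> \<noteq> 0"
    using assms mps_eqI[of f 0] by (auto simp: zero_mps.rep_eq)
  then have bound: "d \<le> total_degree \<alpha>" if "f \<in> order_ge d" for d
    using order_geD[OF that, of \<alpha>] by force
  have ord: "mps_ord f = (GREATEST d. f \<in> order_ge d)"
    by (simp add: mps_ord_def max_ideal_power)
  show "f \<in> order_ge (mps_ord f)"
    unfolding ord by (rule GreatestI_nat[where k = 0 and b = "total_degree \<alpha>"]) (use bound in auto)
  show "d \<le> mps_ord f" if "f \<in> order_ge d"
    unfolding ord by (rule Greatest_le_nat[where b = "total_degree \<alpha>"]) (use bound that in auto)
qed


section \<open>Solving for the coordinate change\<close>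

text \<open>
  This is \<open>\<mm>\<^sup>d (\<mm> f + \<mm>\<^sup>2 j(f))\<close>, or \<open>\<mm>\<^sup>d \<mm>\<^sup>2 j(f)\<close> if \<open>R\<close> holds; the flag lets the right and the contact
  case share one proof.
\<close>

definition tangent_space :: "bool \<Rightarrow> nat \<Rightarrow> ('a::comm_ring_1, 'n::finite) mps \<Rightarrow> ('a, 'n) mps set"
  where "tangent_space R d f = {c * f + (\<Sum>i\<in>UNIV. b i * mps_deriv i f) | c b.
    (R \<longrightarrow> c = 0) \<and> c \<in> order_ge (d + 1) \<and> (\<forall>i. b i \<in> order_ge (d + 2))}"

lemma tangent_spaceI:
  assumes "R \<longrightarrow> c = 0" "c \<in> order_ge (d + 1)" "\<And>i. b i \<in> order_ge (d + 2)"
  shows "c * f + (\<Sum>i\<in>UNIV. b i * mps_deriv i f) \<in> tangent_space R d f"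
  using assms unfolding tangent_space_def by blast

text \<open>Both \<open>c * f\<close> and \<open>b i * mps_deriv i f\<close> gain one order over
  \<open>f\<close>. Combined with the hypothesis of the theorem, this bounds the order of
  \<open>f\<close> by \<open>k + 1\<close>.\<close>

lemma tangent_space_order:
  assumes "f \<in> order_ge d" "d > 0"
  shows "tangent_space R 0 f \<subseteq> order_ge (d + 1)"
proof
  fix h assume "h \<in> tangent_space R 0 f"
  then obtain c b where h: "h = c * f + (\<Sum>i\<in>UNIV. b i * mps_deriv i f)"
    and c: "c \<in> order_ge 1" and b: "\<And>i. b i \<in> order_ge 2"
    unfolding tangent_space_def add_0 by blast
  show "h \<in> order_ge (d + 1)"
    unfolding h using assms(2)
    by (intro order_ge_add order_ge_sum order_ge_mult[OF c assms(1)]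
        order_ge_mult[OF b mps_deriv_in_order_ge[OF assms(1)]]) auto
qed

text \<open>Multiplication by a variable raises the order of the series and of all its coefficients
  \<open>c\<close> and \<open>b\<close> by one; this is repeated \<open>d\<close> times.\<close>

lemma order_ge_subset_tangent_space:
  fixes f :: "('a::comm_ring_1, 'n::finite) mps"
  assumes "order_ge m \<subseteq> tangent_space R 0 f"
  shows "order_ge (m + d) \<subseteq> tangent_space R d f"
proof (induction d)
  case 0
  then show ?case
    using assms by simp
next
  case (Suc d)
  show ?case
  proof
    fix h :: "('a, 'n) mps" assume "h \<in> order_ge (m + Suc d)"
    then obtain t where t: "\<And>i. t i \<in> order_ge (m + d)" and h: "h = (\<Sum>i\<in>UNIV. mps_var i * t i)"
      using order_ge_Suc_decompose[of h "m + d"] by auto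
    \<comment> \<open>Bundles the conditions on the coefficients of \<open>t i\<close>, so that a
      single choice provides them for all \<open>i\<close>.\<close>
    define T where "T i c b \<longleftrightarrow> (R \<longrightarrow> c = 0) \<and> c \<in> order_ge (d + 1) \<and> (\<forall>j. b j \<in> order_ge (d + 2))
        \<and> t i = c * f + (\<Sum>j\<in>UNIV. b j * mps_deriv j f)" for i c b
    have "\<exists>c b. T i c b" for i
      using t[of i] Suc unfolding tangent_space_def T_def by blast
    then obtain c b where "\<And>i. T i (c i) (b i)"
      by metis
    then have R: "R \<longrightarrow> c i = 0" and c: "c i \<in> order_ge (d + 1)" and b: "b i j \<in> order_ge (d + 2)"
      and t: "t i = c i * f + (\<Sum>j\<in>UNIV. b i j * mps_deriv j f)" for i j
      unfolding T_def by blast+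
    define c' where "c' = (\<Sum>i\<in>UNIV. mps_var i * c i)"
    define b' where "b' j = (\<Sum>i\<in>UNIV. mps_var i * b i j)" for j
    have "(\<Sum>i\<in>UNIV. \<Sum>j\<in>UNIV. mps_var i * b i j * mps_deriv j f)
        = (\<Sum>j\<in>UNIV. \<Sum>i\<in>UNIV. mps_var i * b i j * mps_deriv j f)"
      by (rule sum.swap)
    then have "h = c' * f + (\<Sum>j\<in>UNIV. b' j * mps_deriv j f)"
      by (simp only: h t c'_def b'_def distrib_left sum.distrib sum_distrib_left sum_distrib_right
          mult.assoc)
    moreover have "R \<longrightarrow> c' = 0"
      using R by (simp add: c'_def)
    moreover have "c' \<in> order_ge (Suc d + 1)" "b' j \<in> order_ge (Suc d + 2)" for j
      unfolding c'_def b'_def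
      by (intro order_ge_sum order_ge_mult[OF var_in_order_ge c] order_ge_mult[OF var_in_order_ge b]; simp)+
    ultimately show "h \<in> tangent_space R (Suc d) f"
      unfolding tangent_space_def by blast
  qed
qed

text \<open>A Newton-type step whose correction is read off from the tangent space of
  \<open>f\<close> instead of that of \<open>u * mps_subst y g\<close>. The two are so close that
  the discrepancy, multiplied by the small \<open>c\<close> and \<open>b\<close>, exceeds the old
  error bound in order.\<close>

lemma approximation_step:
  fixes f g u :: "('a::comm_ring_1, 'n::finite) mps" and y :: "'n \<Rightarrow> ('a, 'n) mps"
  assumes f: "f \<in> order_ge e" and e: "2 \<le> e"
    and tangent: "order_ge (e + q + 1) \<subseteq> tangent_space R 0 f"
    and fg: "f - g \<in> order_ge (e + 2 * q + 1)"
    and u: "u - 1 \<in> order_ge (q + 1)"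
    and y: "\<And>i. y i - mps_var i \<in> order_ge (q + 2)"
    and res: "u * mps_subst y g - f \<in> order_ge (e + 2 * q + 1 + p)"
  obtains u' y' where "R \<longrightarrow> u' = u" "u' - u \<in> order_ge (q + 1 + p)"
    "\<And>i. y' i - y i \<in> order_ge (q + 2 + p)"
    "u' * mps_subst y' g - f \<in> order_ge (e + 2 * q + 1 + Suc p)"
proof -
  have "e + 2 * q + 1 + p = e + q + 1 + (q + p)"
    by simp
  then have "u * mps_subst y g - f \<in> tangent_space R (q + p) f"
    using order_ge_subset_tangent_space[OF tangent, of "q + p"] res by (metis subsetD)
  then obtain c b where h: "u * mps_subst y g - f = c * f + (\<Sum>i\<in>UNIV. b i * mps_deriv i f)"
    and R: "R \<longrightarrow> c = 0" and c: "c \<in> order_ge (q + p + 1)" and b: "\<And>i. b i \<in> order_ge (q + p + 2)"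
    unfolding tangent_space_def by blast
  define y' where "y' i = y i - b i" for i
  have y1: "y i \<in> order_ge 1" for i
    by (rule near_var_in_order_ge[OF y]) simp
  have y'_diff: "y' i - mps_var i \<in> order_ge (q + 2)" for i
  proof -
    have "y' i - mps_var i = (y i - mps_var i) - b i"
      by (simp add: y'_def algebra_simps)
    also have "\<dots> \<in> order_ge (q + 2)"
      by (rule order_ge_diff[OF y order_ge_mono[OF b]]) simp
    finally show ?thesis .
  qed
  have y'1: "y' i \<in> order_ge 1" for i
    by (rule near_var_in_order_ge[OF y'_diff]) simp
  interpret y: substitution y by standard (rule y1)
  have step: "y' i - y i \<in> order_ge (q + p + 2)" for i
    using order_ge_minus[OF b] by (simp add: y'_def)
  have g: "g \<in> order_ge e"
    using order_ge_diff[OF f order_ge_mono[OF fg, of e]] by simp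
  define D where "D = mps_subst y' g - mps_subst y g + (\<Sum>i\<in>UNIV. b i * mps_subst y (mps_deriv i g))"
  have D_eq: "D = mps_subst y' g - mps_subst y g
      - (\<Sum>i\<in>UNIV. (y' i - y i) * mps_subst y (mps_deriv i g))"
    by (simp add: D_def y'_def sum_negf)
  \<comment> \<open>Taylor gives \<open>2 * (q + p + 2) + (e - 2) = e + 2 * q + 2 * p + 2\<close>,
    at least the required \<open>e + 2 * q + p + 2\<close>.\<close>
  have D: "D \<in> order_ge (e + 2 * q + 1 + Suc p)"
    unfolding D_eq
  proof (rule order_ge_mono)
    have "g \<in> order_ge (e - 2 + 2)"
      using g e by (simp only: le_add_diff_inverse2)
    then show "mps_subst y' g - mps_subst y g
        - (\<Sum>i\<in>UNIV. (y' i - y i) * mps_subst y (mps_deriv i g))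
      \<in> order_ge (2 * (q + p + 2) + (e - 2))"
      by (rule mps_subst_taylor[of y y', OF y1 y'1 step])
  qed (use e in simp)
  \<comment> \<open>Three discrepancies add up: \<open>f\<close> against \<open>g\<close>,
    \<open>y\<close> against the variables, \<open>u\<close> against 1. The last two give exactly
    \<open>e + q\<close>, as \<open>(q + 2) + (e - 1) - 1\<close> and
    \<open>(q + 1) + (e - 1)\<close>.\<close>
  have deriv_diff: "mps_deriv i f - u * mps_subst y (mps_deriv i g) \<in> order_ge (e + q)" for i
  proof -
    have dg: "mps_deriv i g \<in> order_ge (e - 1)"
      by (rule mps_deriv_in_order_ge[OF g])
    have 1: "mps_deriv i (f - g) \<in> order_ge (e + q)"
      by (rule order_ge_mono[OF mps_deriv_in_order_ge[OF fg]]) simp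
    have 2: "mps_subst y (mps_deriv i g) - mps_deriv i g \<in> order_ge (e + q)"
      using order_ge_mono[OF mps_subst_lipschitz[of mps_var y, OF var_in_order_ge y1 y dg], of "e + q"] e
      by (simp add: mps_subst_var)
    have 3: "(u - 1) * mps_subst y (mps_deriv i g) \<in> order_ge (e + q)"
      by (rule order_ge_mult[OF u y.in_order_ge[OF dg]]) (use e in simp)
    have "mps_deriv i f - u * mps_subst y (mps_deriv i g)
      = mps_deriv i (f - g) - (mps_subst y (mps_deriv i g) - mps_deriv i g)
        - (u - 1) * mps_subst y (mps_deriv i g)"
      by (simp add: mps_deriv_diff algebra_simps)
    then show ?thesis
      using order_ge_diff[OF order_ge_diff[OF 1 2] 3] by simp
  qed
  \<comment> \<open>Stated for \<open>y'\<close> because \<open>c\<close> multiplies the updated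
    series in the expansion of the new error.\<close>
  have subst_diff: "mps_subst y' g - f \<in> order_ge (e + q + 1)"
  proof -
    have "mps_subst y' g - g \<in> order_ge (e + q + 1)"
      using order_ge_mono[OF mps_subst_lipschitz[of mps_var y', OF var_in_order_ge y'1 y'_diff g],
          of "e + q + 1"]
      by (simp add: mps_subst_var)
    then show ?thesis
      using order_ge_diff[of "mps_subst y' g - g" "e + q + 1" "f - g"] order_ge_mono[OF fg, of "e + q + 1"]
      by simp
  qed
  show ?thesis
  proof
    show "R \<longrightarrow> u - c = u"
      using R by simp
    show "u - c - u \<in> order_ge (q + 1 + p)"
      using order_ge_minus[OF c] by (simp add: add_ac)
    show "y' i - y i \<in> order_ge (q + 2 + p)" for i
      using step[of i] by (simp add: add_ac)
    define S where "S = (\<Sum>i\<in>UNIV. b i * mps_subst y (mps_deriv i g))"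
    have y'g: "mps_subst y' g = D + mps_subst y g - S"
      by (simp add: D_def S_def)
    define B where "B = (\<Sum>i\<in>UNIV. b i * mps_deriv i f)"
    have uyg: "u * mps_subst y g = f + c * f + B"
      using h unfolding B_def by (simp add: algebra_simps)
    have sum_eq: "(\<Sum>i\<in>UNIV. b i * (mps_deriv i f - u * mps_subst y (mps_deriv i g))) = B - u * S"
      by (simp only: B_def S_def right_diff_distrib sum_subtractf sum_distrib_left mult.left_commute)
    have "(u - c) * mps_subst y' g - f
      = u * mps_subst y g - u * S + u * D - c * mps_subst y' g - f"
      by (simp add: left_diff_distrib) (simp add: y'g algebra_simps)
    also have "\<dots> = (B - u * S) + u * D - c * (mps_subst y' g - f)"
      unfolding uyg by (simp add: right_diff_distrib)
    also have "\<dots> = (\<Sum>i\<in>UNIV. b i * (mps_deriv i f - u * mps_subst y (mps_deriv i g)))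
        + u * D - c * (mps_subst y' g - f)"
      unfolding sum_eq ..
    \<comment> \<open>The two products have orders \<open>(q + p + 2) + (e + q)\<close> and
      \<open>(q + p + 1) + (e + q + 1)\<close>, both exactly the required bound.\<close>
    also have "\<dots> \<in> order_ge (e + 2 * q + 1 + Suc p)"
      by (intro order_ge_diff order_ge_add order_ge_sum order_ge_mult[OF b deriv_diff]
          order_ge_mult[OF c subst_diff] order_ge_mult_left D) simp_all
    finally show "(u - c) * mps_subst y' g - f \<in> order_ge (e + 2 * q + 1 + Suc p)" .
  qed
qed

text \<open>Iterates \<open>approximation_step\<close> from \<open>(1, mps_var)\<close>. The
  corrections at stage \<open>p\<close> have order at least \<open>p\<close>, so the pairs converge,
  and the error of the limit has arbitrarily high order.\<close>

lemma coordinate_change: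
  fixes f g :: "('a::comm_ring_1, 'n::finite) mps"
  assumes f: "f \<in> order_ge e" and e: "2 \<le> e"
    and tangent: "order_ge (e + q + 1) \<subseteq> tangent_space R 0 f"
    and fg: "f - g \<in> order_ge (e + 2 * q + 1)"
  obtains u y where "R \<longrightarrow> u = 1" "u - 1 \<in> order_ge 1"
    "\<And>i. y i - mps_var i \<in> order_ge 2" "f = u * mps_subst y g"
proof -
  define P where "P p X \<longleftrightarrow> (R \<longrightarrow> fst X = 1) \<and> fst X - 1 \<in> order_ge (q + 1) \<and>
      (\<forall>i. snd X i - mps_var i \<in> order_ge (q + 2)) \<and>
      fst X * mps_subst (snd X) g - f \<in> order_ge (e + 2 * q + 1 + p)"
    for p and X :: "('a, 'n) mps \<times> ('n \<Rightarrow> ('a, 'n) mps)"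
  \<comment> \<open>Weaker than the bounds \<open>q + 1 + p\<close> and \<open>q + 2 + p\<close>
    from the step, but in the form that \<open>order_ge_limit\<close> expects.\<close>
  define Q where "Q p X X' \<longleftrightarrow> fst X' - fst X \<in> order_ge p \<and> (\<forall>i. snd X' i - snd X i \<in> order_ge p)"
    for p and X X' :: "('a, 'n) mps \<times> ('n \<Rightarrow> ('a, 'n) mps)"
  have "\<exists>X. P 0 X"
    by (rule exI[of _ "(1, mps_var)"]) (simp add: P_def mps_subst_var order_ge_minus_swap[OF fg, simplified])
  moreover have "\<exists>X'. P (Suc p) X' \<and> Q p X X'" if X: "P p X" for p X
  proof -
    obtain u' y' where "R \<longrightarrow> u' = fst X" and u': "u' - fst X \<in> order_ge (q + 1 + p)"
      and y': "\<And>i. y' i - snd X i \<in> order_ge (q + 2 + p)"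
      and res: "u' * mps_subst y' g - f \<in> order_ge (e + 2 * q + 1 + Suc p)"
      using approximation_step[OF f e tangent fg, of "fst X" "snd X" p] X unfolding P_def by blast
    have "(u' - fst X) + (fst X - 1) \<in> order_ge (q + 1)"
      by (rule order_ge_add[OF order_ge_mono[OF u']]) (use X in \<open>auto simp: P_def\<close>)
    moreover have "(y' i - snd X i) + (snd X i - mps_var i) \<in> order_ge (q + 2)" for i
      by (rule order_ge_add[OF order_ge_mono[OF y']]) (use X in \<open>auto simp: P_def\<close>)
    ultimately have "P (Suc p) (u', y')"
      using res X \<open>R \<longrightarrow> u' = fst X\<close> by (simp add: P_def)
    moreover have "Q p X (u', y')"
      using order_ge_mono[OF u', of p] order_ge_mono[OF y', of p] by (simp add: Q_def)
    ultimately show ?thesis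
      by blast
  qed
  ultimately obtain X where P: "\<And>p. P p (X p)" and Q: "\<And>p. Q p (X p) (X (Suc p))"
    using dependent_nat_choice[of P Q] by blast
  obtain u where u: "\<And>p. u - fst (X p) \<in> order_ge p"
    using order_ge_limit[of "\<lambda>p. fst (X p)"] Q unfolding Q_def by blast
  have "\<exists>z. \<forall>p. z - snd (X p) i \<in> order_ge p" for i
    using order_ge_limit[of "\<lambda>p. snd (X p) i"] Q unfolding Q_def by metis
  then obtain y where y: "\<And>p i. y i - snd (X p) i \<in> order_ge p"
    by metis
  show ?thesis
  proof
    show "R \<longrightarrow> u = 1"
    proof
      assume R
      then have "u - 1 \<in> order_ge p" for p
        using u[of p] P[of p] by (simp add: P_def)
      then show "u = 1"
        by (rule order_ge_all_imp_eq)
    qed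
    have "(u - fst (X 1)) + (fst (X 1) - 1) \<in> order_ge 1"
      using P[of 1] by (intro order_ge_add u) (auto simp: P_def intro: order_ge_mono)
    then show "u - 1 \<in> order_ge 1"
      by simp
    \<comment> \<open>Stage 2 is chosen because the limit agrees with it up to order 2.\<close>
    have "(y i - snd (X 2) i) + (snd (X 2) i - mps_var i) \<in> order_ge 2" for i
      using P[of 2] by (intro order_ge_add y) (auto simp: P_def intro: order_ge_mono)
    then show y2: "y i - mps_var i \<in> order_ge 2" for i
      by simp
    have y1: "y i \<in> order_ge 1" for i
      by (rule near_var_in_order_ge[OF y2]) simp
    have "u * mps_subst y g - f \<in> order_ge d" for d
    proof -
      \<comment> \<open>One extra stage pays for the order lost in
        \<open>mps_subst_lipschitz\<close> when \<open>g\<close> is only taken to have order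
        0.\<close>
      define p where "p = d + 1"
      have "snd (X p) i - mps_var i \<in> order_ge 2" for i
        using P[of p] by (auto simp: P_def intro: order_ge_mono)
      then have Xp: "snd (X p) i \<in> order_ge 1" for i
        by (rule near_var_in_order_ge) simp
      have "mps_subst y g - mps_subst (snd (X p)) g \<in> order_ge d"
        using mps_subst_lipschitz[OF Xp y1 y, of g 0] by (simp add: p_def)
      moreover have "u - fst (X p) \<in> order_ge d"
        by (rule order_ge_mono[OF u]) (simp add: p_def)
      moreover have "fst (X p) * mps_subst (snd (X p)) g - f \<in> order_ge d"
        using P[of p] by (auto simp: P_def p_def intro: order_ge_mono)
      moreover have "u * mps_subst y g - f = mps_subst y g * (u - fst (X p))
          + fst (X p) * (mps_subst y g - mps_subst (snd (X p)) g)
          + (fst (X p) * mps_subst (snd (X p)) g - f)"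
        by (simp add: algebra_simps)
      ultimately show ?thesis
        by (simp only:) (intro order_ge_add order_ge_mult_left)
    qed
    then show "f = u * mps_subst y g"
      by (rule order_ge_all_imp_eq[symmetric])
  qed
qed

theorem theorem2p1:
  fixes f :: "('a::alg_closed_field, 'n::finite) mps" and k :: nat
  assumes "f \<noteq> 0" and "f \<in> \<mm> ^\<^sub>i 2"
  shows "(\<mm> ^\<^sub>i (k + 2) \<subseteq> \<mm> ^\<^sub>i 2 \<cdot>\<^sub>i jacobian_ideal f
            \<longrightarrow> right_determined (2 * k - mps_ord f + 2) f) \<and>
         (\<mm> ^\<^sub>i (k + 2) \<subseteq> \<mm> \<cdot>\<^sub>i ideal {f} + \<mm> ^\<^sub>i 2 \<cdot>\<^sub>i jacobian_ideal f
            \<longrightarrow> contact_determined (2 * k - mps_ord f + 2) f)"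
proof -
  define e where "e = mps_ord f"
  have f: "f \<in> order_ge e"
    unfolding e_def by (rule in_order_ge_mps_ord[OF assms(1)])
  have e: "2 \<le> e"
    using le_mps_ord[OF assms(1)] assms(2) unfolding e_def max_ideal_power .
  \<comment> \<open>Common to both parts: under \<open>R\<close> the unit is 1, and the automorphism
    alone carries \<open>g\<close> to \<open>f\<close>.\<close>
  have solve: "\<exists>u y. (R \<longrightarrow> u = 1) \<and> u dvd 1 \<and> mps_automorphism (mps_subst y) \<and> f = u * mps_subst y g"
    if tangent: "order_ge (k + 2) \<subseteq> tangent_space R 0 f"
      and fg: "f - g \<in> \<mm> ^\<^sub>i (2 * k - e + 2 + 1)" for R g
  proof -
    \<comment> \<open>The tangent space lies in order \<open>e + 1\<close>, so it can contain all
      series of order \<open>k + 2\<close> only under this inequality; it makes \<open>q\<close> a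
      natural number.\<close>
    have "e + 1 \<le> k + 2"
      using tangent tangent_space_order[OF f, of R] e
      by (intro order_ge_subset_imp_le[where 'a = 'a and 'n = 'n]) auto
    then obtain q where q: "k + 1 = e + q"
      using le_Suc_ex[of e "k + 1"] by auto
    \<comment> \<open>The truncated subtraction is harmless: \<open>k + 1 = e + q\<close> and
      \<open>e \<ge> 2\<close> give \<open>2 * k \<ge> e\<close>.\<close>
    have exponents: "k + 2 = e + q + 1" "2 * k - e + 2 + 1 = e + 2 * q + 1"
      using q e by auto
    have fg': "f - g \<in> order_ge (e + 2 * q + 1)"
      using fg by (simp only: max_ideal_power exponents)
    obtain u y where uy: "R \<longrightarrow> u = 1" "u - 1 \<in> order_ge 1"
      "\<And>i. y i - mps_var i \<in> order_ge 2" "f = u * mps_subst y g"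
      using coordinate_change[OF f e tangent[unfolded exponents] fg'] by blast
    interpret substitution y
      by standard (rule near_var_in_order_ge[OF uy(3)], simp)
    show ?thesis
      using uy automorphism unit_of_one_plus_order_ge_1 by blast
  qed
  have jacobian: "\<exists>b. (\<forall>i. b i \<in> order_ge 2) \<and> h = (\<Sum>i\<in>UNIV. b i * mps_deriv i f)"
    if "h \<in> \<mm> ^\<^sub>i 2 \<cdot>\<^sub>i jacobian_ideal f" for h
    using that order_ge_prod_ideal_range[of "\<mm> ^\<^sub>i 2" 2 h "\<lambda>i. mps_deriv i f"]
    unfolding max_ideal_power jacobian_ideal_def by blast
  \<comment> \<open>With index type \<open>unit\<close> the range of the constant family is
    \<open>{f}\<close>.\<close>
  have principal: "\<exists>c \<in> order_ge 1. h = c * f" if "h \<in> \<mm> \<cdot>\<^sub>i ideal {f}" for h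
    using that order_ge_prod_ideal_range[OF max_ideal_subset, of h "\<lambda>_ :: unit. f"]
    by (auto simp: UNIV_unit)
  show ?thesis
  proof (intro conjI impI)
    assume "\<mm> ^\<^sub>i (k + 2) \<subseteq> \<mm> ^\<^sub>i 2 \<cdot>\<^sub>i jacobian_ideal f"
    moreover have "h \<in> tangent_space True 0 f" if h: "h \<in> \<mm> ^\<^sub>i 2 \<cdot>\<^sub>i jacobian_ideal f" for h
    proof -
      obtain b where b: "\<And>i. b i \<in> order_ge 2" "h = (\<Sum>i\<in>UNIV. b i * mps_deriv i f)"
        using jacobian[OF h] by blast
      then have "0 * f + h \<in> tangent_space True 0 f"
        unfolding b(2) by (intro tangent_spaceI) (simp_all only: add_0 zero_in_order_ge simp_thms)
      then show ?thesis
        by simp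
    qed
    ultimately have "order_ge (k + 2) \<subseteq> tangent_space True 0 f"
      unfolding max_ideal_power by blast
    then show "right_determined (2 * k - mps_ord f + 2) f"
      unfolding right_determined_def right_equivalent_def e_def[symmetric]
      using solve[of True] by (metis mult_1)
  next
    assume "\<mm> ^\<^sub>i (k + 2) \<subseteq> \<mm> \<cdot>\<^sub>i ideal {f} + \<mm> ^\<^sub>i 2 \<cdot>\<^sub>i jacobian_ideal f"
    moreover have "h \<in> tangent_space False 0 f"
      if h: "h \<in> \<mm> \<cdot>\<^sub>i ideal {f} + \<mm> ^\<^sub>i 2 \<cdot>\<^sub>i jacobian_ideal f" for h
    proof -
      obtain h1 h2 where "h1 \<in> \<mm> \<cdot>\<^sub>i ideal {f}" "h2 \<in> \<mm> ^\<^sub>i 2 \<cdot>\<^sub>i jacobian_ideal f" "h = h1 + h2"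
        using h by (rule set_plus_elim)
      moreover obtain c where "c \<in> order_ge 1" "h1 = c * f"
        using principal calculation(1) by blast
      moreover obtain b where "\<And>i. b i \<in> order_ge 2" "h2 = (\<Sum>i\<in>UNIV. b i * mps_deriv i f)"
        using jacobian calculation(2) by blast
      ultimately show ?thesis
        by (simp only:) (intro tangent_spaceI; simp only: add_0 simp_thms)
    qed
    ultimately have "order_ge (k + 2) \<subseteq> tangent_space False 0 f"
      unfolding max_ideal_power by blast
    then show "contact_determined (2 * k - mps_ord f + 2) f"
      unfolding contact_determined_def contact_equivalent_def e_def[symmetric]
      using solve[of False] by blast
  qed
qed

end
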